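(* Let $n\ge2$. For every $m\in\mathbb{N}$, $\mathbb{Z}^m$ quasi-isometrically embeds into $\mathrm{Cay}(F_n,\mathrm{sep}_n)$.
   Context: $F_n$ is the free group of rank $n$. A free factor is a subgroup generated by a subset of a basis; it is proper if it is not all of $F_n$. An element of $F_n$ is separable if it lies in a proper free factor; $\mathrm{sep}_n$ denotes the set of separable elements (a conjugation invariant generating set). $\mathrm{Cay}(G,S)$ is the graph with vertex set $G$ and an undirected edge between $g$ and $sg$ for $g\in G$, $s\in S$, with the path metric; $\mathbb Z^m$ has the $\ell^1$ metric. *)

theory Defs
  imports Complex_Main "HOL-Algebra.Generated_Groups"
begin

definition word_eval :: "('a, 'b) monoid_scheme \<Rightarrow> ('a \<times> bool) list \<Rightarrow> 'a" where
  "word_eval G w = foldr (\<lambda>(x, e) acc. (if e then x else inv\<^bsub>G\<^esub> x) \<otimes>\<^bsub>G\<^esub> acc) w \<one>\<^bsub>G\<^esub>"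

definition reduced_word :: "('a \<times> bool) list \<Rightarrow> bool" where
  "reduced_word w \<longleftrightarrow>
     (\<forall>i. Suc i < length w \<longrightarrow> \<not> (fst (w ! i) = fst (w ! Suc i) \<and> snd (w ! i) \<noteq> snd (w ! Suc i)))"

definition free_basis :: "('a, 'b) monoid_scheme \<Rightarrow> 'a set \<Rightarrow> bool" where
  "free_basis G B \<longleftrightarrow> B \<subseteq> carrier G \<and> generate G B = carrier G \<and>
     (\<forall>w. set w \<subseteq> B \<times> UNIV \<and> reduced_word w \<and> w \<noteq> [] \<longrightarrow> word_eval G w \<noteq> \<one>\<^bsub>G\<^esub>)"

definition free_group_rank :: "('a, 'b) monoid_scheme \<Rightarrow> nat \<Rightarrow> bool" where
  "free_group_rank G n \<longleftrightarrow> group G \<and> (\<exists>B. free_basis G B \<and> finite B \<and> card B = n)"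

definition free_factor :: "('a, 'b) monoid_scheme \<Rightarrow> 'a set \<Rightarrow> bool" where
  "free_factor G H \<longleftrightarrow> (\<exists>B A. free_basis G B \<and> A \<subseteq> B \<and> H = generate G A)"

definition proper_free_factor :: "('a, 'b) monoid_scheme \<Rightarrow> 'a set \<Rightarrow> bool" where
  "proper_free_factor G H \<longleftrightarrow> free_factor G H \<and> H \<noteq> carrier G"

definition sep :: "('a, 'b) monoid_scheme \<Rightarrow> 'a set" where
  "sep G = \<Union> {H. proper_free_factor G H}"

definition cay_edges :: "('a, 'b) monoid_scheme \<Rightarrow> 'a set \<Rightarrow> ('a \<times> 'a) set" where
  "cay_edges G S = {(g, h). g \<in> carrier G \<and> h \<in> carrier G \<and>
      (\<exists>s\<in>S. h = s \<otimes>\<^bsub>G\<^esub> g \<or> g = s \<otimes>\<^bsub>G\<^esub> h)}"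

definition cay_dist :: "('a, 'b) monoid_scheme \<Rightarrow> 'a set \<Rightarrow> 'a \<Rightarrow> 'a \<Rightarrow> nat" where
  "cay_dist G S g h = (LEAST k. (g, h) \<in> (cay_edges G S) ^^ k)"

text \<open>Z^m as integer lists of length m with the l1 metric.\<close>

definition l1_dist :: "int list \<Rightarrow> int list \<Rightarrow> int" where
  "l1_dist x y = (\<Sum>i<length x. \<bar>x ! i - y ! i\<bar>)"

definition qi_embedding_Zm :: "nat \<Rightarrow> ('a, 'b) monoid_scheme \<Rightarrow> 'a set \<Rightarrow> (int list \<Rightarrow> 'a) \<Rightarrow> bool" where
  "qi_embedding_Zm m G S f \<longleftrightarrow>
     (\<forall>x. length x = m \<longrightarrow> f x \<in> carrier G) \<and>
     (\<exists>L C::real. L \<ge> 1 \<and> C \<ge> 0 \<and>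
        (\<forall>x y. length x = m \<longrightarrow> length y = m \<longrightarrow>
           real_of_int (l1_dist x y) / L - C \<le> real (cay_dist G S (f x) (f y)) \<and>
           real (cay_dist G S (f x) (f y)) \<le> L * real_of_int (l1_dist x y) + C))"

end

(* Since sep_n is invariant under conjugation, the Cayley graph carries a bi-invariant metric, so
   x |-> g_0^{x_0} ... g_{m-1}^{x_{m-1}} is Lipschitz for every choice of the g_j.  The lower bound
   comes from Brooks counting quasimorphisms: if w_j contains every reduced two-letter word, then the
   quasimorphism "occurrences of w_j minus occurrences of w_j^{-1}" is bounded on sep_n, hence
   Lipschitz.  Taking for g_j the elements spelled by words w_j of equal length whose rotations and
   inverses are distinguished by counting one letter, the j-th quasimorphism recovers the j-th
   coordinate up to a bounded error.

   Boundedness on sep_n is a weak form of Whitehead's cut vertex lemma.  If g lies in <A> and b is a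
   basis element outside A, the set X of elements whose normal form in that other basis starts with b
   satisfies X<A> = X, is infinite and coinfinite, and has finite coboundary in the Cayley tree of the
   fixed basis.  If a cyclically reduced word c contains all reduced two-letter words, some translate
   of its axis has its two ends on different sides of X, so c does not represent an element of <A>. *)

theory Submission
  imports Defs "HOL-Library.Sublist"
begin

section \<open>Reduced words\<close>

definition linv :: "'a \<times> bool \<Rightarrow> 'a \<times> bool" where
  "linv a = (fst a, \<not> snd a)"

definition winv :: "('a \<times> bool) list \<Rightarrow> ('a \<times> bool) list" where
  "winv w = rev (map linv w)"

text \<open>Reduced words over \<open>B\<close> serve as the vertices of the Cayley tree; dropping
  the last letter leads to the parent.\<close>

definition rwords :: "'a set \<Rightarrow> ('a \<times> bool) list set" where
  "rwords B = {w. set w \<subseteq> B \<times> UNIV \<and> reduced_word w}"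

abbreviation wpow :: "nat \<Rightarrow> 'b list \<Rightarrow> 'b list" where
  "wpow k w \<equiv> concat (replicate k w)"

lemma linv_linv [simp]: "linv (linv a) = a"
  by (simp add: linv_def)

lemma linv_neq [simp]: "linv a \<noteq> a" "a \<noteq> linv a"
  by (cases a; simp add: linv_def)+

lemma linv_in_letters [simp]: "linv a \<in> B \<times> UNIV \<longleftrightarrow> a \<in> B \<times> UNIV"
  by (cases a) (simp add: linv_def)

lemma linv_eq_iff: "linv a = b \<longleftrightarrow> a = linv b"
  by (auto simp: linv_def)

lemma linv_inject [simp]: "linv a = linv b \<longleftrightarrow> a = b"
  by (metis linv_linv)

lemma winv_simps [simp]:
  "winv [] = []" "winv (a # w) = winv w @ [linv a]" "winv (u @ v) = winv v @ winv u"
  "winv (winv w) = w" "length (winv w) = length w" "winv w = [] \<longleftrightarrow> w = []"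
  by (simp_all add: winv_def rev_map o_def)

lemma set_winv_subset [simp]: "set (winv w) \<subseteq> B \<times> UNIV \<longleftrightarrow> set w \<subseteq> B \<times> UNIV"
  by (induction w) auto

lemma last_winv: "w \<noteq> [] \<Longrightarrow> last (winv w) = linv (hd w)"
  by (simp add: winv_def last_rev hd_map)

lemma winv_wpow: "winv (wpow k w) = wpow k (winv w)"
proof (induction k)
  case (Suc k)
  have "wpow k (winv w) @ winv w = winv w @ wpow k (winv w)"
    by (metis (no_types) append_Nil2 concat.simps(1,2) concat_append replicate_Suc replicate_app_Cons_same)
  then show ?case using Suc by simp
qed simp

lemma reduced_word_iff: "reduced_word w \<longleftrightarrow> successively (\<lambda>a b. b \<noteq> linv a) w"
  unfolding reduced_word_def successively_conv_nth
  by (auto simp: linv_def prod_eq_iff)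

lemma reduced_word_simps [simp]:
  "reduced_word []" "reduced_word [a]"
  "reduced_word (a # b # w) \<longleftrightarrow> b \<noteq> linv a \<and> reduced_word (b # w)"
  by (simp_all add: reduced_word_iff)

lemma reduced_word_append:
  "reduced_word (u @ v) \<longleftrightarrow>
     reduced_word u \<and> reduced_word v \<and> (u \<noteq> [] \<longrightarrow> v \<noteq> [] \<longrightarrow> hd v \<noteq> linv (last u))"
  by (auto simp: reduced_word_iff successively_append_iff)

lemma reduced_word_winv [simp]: "reduced_word (winv w) \<longleftrightarrow> reduced_word w"
proof -
  have "reduced_word (winv w)" if "reduced_word w" for w :: "('a \<times> bool) list"
    using that
  proof (induction w)
    case (Cons a w)
    then show ?case
      by (cases w) (auto simp: reduced_word_append)
  qed simp
  then show ?thesis by (metis winv_simps(4))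
qed

lemma rwords_append:
  "u @ v \<in> rwords B \<longleftrightarrow>
     u \<in> rwords B \<and> v \<in> rwords B \<and> (u \<noteq> [] \<longrightarrow> v \<noteq> [] \<longrightarrow> hd v \<noteq> linv (last u))"
  by (auto simp: rwords_def reduced_word_append)

lemma rwords_winv [simp]: "winv w \<in> rwords B \<longleftrightarrow> w \<in> rwords B"
  by (simp add: rwords_def)

lemma rwords_Nil [simp]: "[] \<in> rwords B"
  by (simp add: rwords_def)

lemma rwords_single [simp]: "[a] \<in> rwords B \<longleftrightarrow> a \<in> B \<times> UNIV"
  by (simp add: rwords_def)

text \<open>\<open>c @ c \<in> rwords B\<close> encodes that \<open>c\<close> is cyclically reduced:
  every junction between two copies of \<open>c\<close> in a power already occurs in
  \<open>c @ c\<close>.\<close>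

lemma rwords_wpow:
  assumes "c @ c \<in> rwords B"
  shows "wpow k c \<in> rwords B"
proof (induction k)
  case (Suc k)
  show ?case
  proof (cases "c = [] \<or> k = 0")
    case False
    then obtain j where "k = Suc j" by (cases k) auto
    then show ?thesis using Suc assms False by (auto simp: rwords_append)
  qed (use assms Suc in \<open>auto simp: rwords_append\<close>)
qed simp

text \<open>Peel letters off the end of \<open>u\<close> as long as they cancel against the head of
  \<open>v\<close>; \<open>t\<close> collects what cancels, and \<open>p @ q\<close> is the reduced
  form of the product.\<close>

lemma reduced_decomposition:
  assumes "u \<in> rwords B" "v \<in> rwords B"
  obtains p t q where "u = p @ t" "v = winv t @ q" "p @ q \<in> rwords B"
proof -
  have "\<exists>p t q. u = p @ t \<and> v = winv t @ q \<and> p @ q \<in> rwords B"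
    using assms
  proof (induction u arbitrary: v rule: rev_induct)
    case (snoc a u)
    show ?case
    proof (cases "v \<noteq> [] \<and> hd v = linv a")
      case True
      then obtain v' where v: "v = linv a # v'" by (cases v) auto
      with snoc.prems have "u \<in> rwords B" "v' \<in> rwords B"
        using rwords_append[of "[linv a]" v' B] by (auto simp: rwords_append)
      then obtain p t q where "u = p @ t" "v' = winv t @ q" "p @ q \<in> rwords B"
        using snoc.IH by blast
      then have "u @ [a] = p @ (t @ [a]) \<and> v = winv (t @ [a]) @ q \<and> p @ q \<in> rwords B"
        using v by simp
      then show ?thesis by blast
    next
      case False
      then have "(u @ [a]) @ v \<in> rwords B"
        using snoc.prems by (subst rwords_append) auto
      then show ?thesis
        by (intro exI[of _ "u @ [a]"] exI[of _ "[]"] exI[of _ v]) auto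
    qed
  qed (metis append_Nil winv_simps(1))
  then show ?thesis using that by blast
qed

text \<open>An outer pair of mutually inverse letters can be moved into the conjugator
  \<open>u\<close>. What remains is shorter, so the process stops at a cyclically reduced
  core.\<close>

lemma cyclic_reduction:
  assumes "w \<in> rwords B"
  obtains u c where "w = u @ c @ winv u" "c @ c \<in> rwords B"
proof -
  have "\<exists>u c. w = u @ c @ winv u \<and> c @ c \<in> rwords B"
    using assms
  proof (induction w rule: length_induct)
    case (1 w)
    show ?case
    proof (cases "w = [] \<or> hd w \<noteq> linv (last w)")
      case True
      then show ?thesis using 1(2)
        by (intro exI[of _ "[]"] exI[of _ w]) (auto simp: rwords_append)
    next
      case False
      then have "length w \<noteq> 1" by (auto simp: length_Suc_conv)
      with False obtain a v b where w: "w = a # v @ [b]"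
        by (metis One_nat_def append_butlast_last_id length_Cons list.exhaust list.size(3))
      with False have a: "b = linv a" by (simp add: linv_eq_iff)
      have "v \<in> rwords B" using 1(2) w rwords_append[of "[a]" "v @ [b]" B]
        by (auto simp: rwords_append)
      moreover have "length v < length w" using w by simp
      ultimately obtain u c where "v = u @ c @ winv u" "c @ c \<in> rwords B"
        using 1(1) by blast
      then have "w = (a # u) @ c @ winv (a # u) \<and> c @ c \<in> rwords B" using w a by simp
      then show ?thesis by blast
    qed
  qed
  then show ?thesis using that by blast
qed

text \<open>Rank at least two gives four letters, so one can be chosen that avoids cancellation on
  both sides.\<close>

lemma avoid_two_letters:
  assumes "card B \<ge> 2"
  obtains z where "z \<in> B \<times> (UNIV :: bool set)" "z \<noteq> p" "z \<noteq> q"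
proof -
  have fin: "finite B" using assms by (metis card.infinite not_numeral_le_zero)
  have "card (B \<times> (UNIV :: bool set)) \<ge> 4" using assms by (simp add: card_cartesian_product)
  moreover have "card {p, q} \<le> 2" by (simp add: card_insert_if)
  ultimately have "\<not> B \<times> (UNIV :: bool set) \<subseteq> {p, q}"
    using card_mono[of "{p, q}" "B \<times> (UNIV :: bool set)"] by auto
  then show ?thesis using that by blast
qed

text \<open>An edge of the tree is recorded by its lower endpoint \<open>h\<close>, the upper one
  being \<open>butlast h\<close>; the root \<open>[]\<close> has no edge above it.\<close>

definition coboundary :: "'a set \<Rightarrow> ('a \<times> bool) list set \<Rightarrow> ('a \<times> bool) list set" where
  "coboundary B Y = {h \<in> rwords B. h \<noteq> [] \<and> (butlast h \<in> Y \<longleftrightarrow> h \<notin> Y)}"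

text \<open>Two-letter subwords are the turns taken in the tree by a path that reads
  \<open>c\<close>. Having all of them makes the Whitehead graph of \<open>c\<close>
  complete.\<close>

definition full_word :: "'a set \<Rightarrow> ('a \<times> bool) list \<Rightarrow> bool" where
  "full_word B c \<longleftrightarrow> (\<forall>a b. [a, b] \<in> rwords B \<longrightarrow> sublist [a, b] c)"

lemma coboundary_cases:
  assumes "h \<in> coboundary B Y"
  obtains v z where "h = v @ [z]" "v @ [z] \<in> rwords B" "v \<in> Y \<longleftrightarrow> v @ [z] \<notin> Y"
  using assms by (cases h rule: rev_cases) (auto simp: coboundary_def)

text \<open>Every edge on the way down from \<open>h\<close> has a lower endpoint longer than
  \<open>h\<close>, hence lies outside the coboundary.\<close>

lemma same_side_beyond:
  assumes "h @ t \<in> rwords B" and "\<And>g. g \<in> coboundary B Y \<Longrightarrow> length g \<le> length h"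
  shows "h @ t \<in> Y \<longleftrightarrow> h \<in> Y"
  using assms(1)
proof (induction t rule: rev_induct)
  case (snoc a t)
  then have "h @ t @ [a] \<notin> coboundary B Y" using assms(2)[of "h @ t @ [a]"] by auto
  moreover have "h @ t \<in> rwords B" using snoc.prems by (auto simp: rwords_append)
  ultimately show ?case using snoc by (auto simp: coboundary_def butlast_append)
qed simp

lemma coboundary_empty:
  assumes "coboundary B Y = {}"
  shows "rwords B \<subseteq> Y \<or> rwords B \<inter> Y = {}"
  using same_side_beyond[of "[]" _ B Y] assms by auto

text \<open>Pass to a finite modification of \<open>Y\<close> with smallest coboundary and take its
  deepest edge, from \<open>v\<close> to a child. Minimality leaves another child of
  \<open>v\<close> on the side of \<open>v\<close>. A full word takes the turn between these two
  children, so a translate of its axis runs through \<open>v\<close> into both subtrees, each of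
  which lies on one side.\<close>

lemma separating_line:
  fixes B :: "'a set"
  assumes B: "card B \<ge> 2"
    and finY: "finite (coboundary B Y)"
    and infY: "infinite (rwords B \<inter> Y)" "infinite (rwords B - Y)"
    and c: "c @ c \<in> rwords B" "full_word B c"
  obtains v \<alpha> \<beta> k where "c = \<alpha> @ \<beta>" "v @ \<beta> @ wpow k c \<in> rwords B"
    "v @ winv \<alpha> @ wpow k (winv c) \<in> rwords B"
    "v @ \<beta> @ wpow k c \<in> Y \<longleftrightarrow> v @ winv \<alpha> @ wpow k (winv c) \<notin> Y"
proof -
  define fmod where "fmod Z \<longleftrightarrow> finite (coboundary B Z) \<and> finite ((Z - Y) \<union> (Y - Z))" for Z
  have "fmod Y" using finY by (simp add: fmod_def)
  then obtain Z where Z: "fmod Z"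
    and minZ: "\<And>Z'. fmod Z' \<Longrightarrow> card (coboundary B Z) \<le> card (coboundary B Z')"
    using ex_has_least_nat[of fmod Y "\<lambda>Z. card (coboundary B Z)"] by blast
  have finZ: "finite (coboundary B Z)" and diff: "finite ((Z - Y) \<union> (Y - Z))"
    using Z by (auto simp: fmod_def)
  \<comment> \<open>Otherwise \<open>Z\<close> contains all vertices or none, and an infinite part
    of the tree would lie in its finite difference from \<open>Y\<close>.\<close>
  have "coboundary B Z \<noteq> {}"
  proof
    assume "coboundary B Z = {}"
    then have "rwords B - Y \<subseteq> Z - Y \<or> rwords B \<inter> Y \<subseteq> Y - Z"
      using coboundary_empty[of B Z] by blast
    then show False using diff infY finite_subset by blast
  qed
  then obtain h where h: "h \<in> coboundary B Z"
    and hmax: "\<And>g. g \<in> coboundary B Z \<Longrightarrow> length g \<le> length h"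
    using finZ obtains_MAX[of "coboundary B Z" length] by (metis Max_ge finite_imageI imageI)
  obtain v z where vz: "h = v @ [z]"
    using h by (rule coboundary_cases)
  have vR: "v \<in> rwords B" and hR: "v @ [z] \<in> rwords B"
    using h vz by (auto simp: coboundary_def rwords_append)
  have deep: "v @ a # t \<in> Z \<longleftrightarrow> v @ [a] \<in> Z" if "v @ a # t \<in> rwords B" for a t
    using same_side_beyond[of "v @ [a]" t B Z] that hmax vz by auto
  \<comment> \<open>If every edge from \<open>v\<close> to a child were in the coboundary, moving \<open>v\<close> to the other side of \<open>Z\<close>
    would remove all of them and add at most the edge above \<open>v\<close>.\<close>
  have "\<exists>y. v @ [y] \<in> rwords B \<and> v @ [y] \<notin> coboundary B Z"
  proof (rule ccontr)
    assume "\<not> ?thesis"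
    then have all: "v @ [y] \<in> coboundary B Z" if "v @ [y] \<in> rwords B" for y
      using that by blast
    define Z' where "Z' = (if v \<in> Z then Z - {v} else insert v Z)"
    have Z': "w \<in> Z' \<longleftrightarrow> (w \<in> Z \<longleftrightarrow> w \<noteq> v)" for w by (auto simp: Z'_def)
    obtain z' where z': "z' \<in> B \<times> UNIV" "z' \<noteq> linv (last v)" "z' \<noteq> z"
      using avoid_two_letters[OF B] .
    then have z'R: "v @ [z'] \<in> rwords B" using vR by (simp add: rwords_append)
    have sub: "coboundary B Z' \<subseteq> insert v (coboundary B Z - {v @ [z], v @ [z']})"
    proof
      fix g assume g: "g \<in> coboundary B Z'"
      then obtain g' a where g': "g = g' @ [a]" "g \<in> rwords B"
        by (metis coboundary_cases)
      show "g \<in> insert v (coboundary B Z - {v @ [z], v @ [z']})"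
      proof (cases "g = v")
        case False
        have "g' \<noteq> v"
        proof
          assume "g' = v"
          then have "g \<in> coboundary B Z" using all g' by simp
          with g g' \<open>g' = v\<close> show False by (auto simp: coboundary_def Z')
        qed
        then show ?thesis using g g' False by (auto simp: coboundary_def Z')
      qed auto
    qed
    have "{v @ [z], v @ [z']} \<subseteq> coboundary B Z" using all hR z'R by auto
    then have "card (coboundary B Z - {v @ [z], v @ [z']}) + 2 = card (coboundary B Z)"
      using finZ z' card_mono[of "coboundary B Z" "{v @ [z], v @ [z']}"]
      by (simp add: card_Diff_subset)
    moreover have "card (coboundary B Z') \<le> Suc (card (coboundary B Z - {v @ [z], v @ [z']}))"
      using finZ card_mono[OF _ sub] by (simp add: card_insert_if split: if_splits)
    moreover have "fmod Z'"
    proof -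
      have "(Z' - Y) \<union> (Y - Z') \<subseteq> insert v ((Z - Y) \<union> (Y - Z))" by (auto simp: Z')
      then show ?thesis using sub finZ diff
        by (auto simp: fmod_def dest!: finite_subset)
    qed
    ultimately show False using minZ[of Z'] by simp
  qed
  then obtain y where y: "v @ [y] \<in> rwords B" "v @ [y] \<notin> coboundary B Z"
    by blast
  have vy: "v @ [y] \<in> Z \<longleftrightarrow> v \<in> Z" and vz': "v @ [z] \<in> Z \<longleftrightarrow> v \<notin> Z"
    using y h vz by (auto simp: coboundary_def)
  have "y \<noteq> z" using y(2) h vz by auto
  then have "[linv y, z] \<in> rwords B"
    using y hR by (auto simp: rwords_def reduced_word_append)
  then have "sublist [linv y, z] c" using c(2) unfolding full_word_def by blast
  then obtain p q where pq: "c = p @ [linv y, z] @ q"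
    unfolding sublist_def by blast
  \<comment> \<open>Cutting \<open>c\<close> in the middle of the turn puts the cut at
    \<open>v\<close>: forwards the axis leaves along \<open>z\<close>, backwards along
    \<open>y\<close>.\<close>
  define \<alpha> where "\<alpha> = p @ [linv y]"
  define \<beta> where "\<beta> = z # q"
  have cab: "c = \<alpha> @ \<beta>" using pq by (simp add: \<alpha>_def \<beta>_def)
  have pc: "wpow (Suc k) c \<in> rwords B" for k using rwords_wpow[OF c(1)] .
  have r1: "v @ \<beta> @ wpow k c \<in> rwords B" for k
  proof -
    have "\<beta> @ wpow k c \<in> rwords B" using pc[of k] cab by (simp add: rwords_append)
    then show ?thesis using hR by (auto simp: rwords_append \<beta>_def)
  qed
  have r2: "v @ winv \<alpha> @ wpow k (winv c) \<in> rwords B" for k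
  proof -
    have "winv c @ winv c \<in> rwords B" using c(1) rwords_winv[of "c @ c" B] by simp
    then have "winv c @ wpow k (winv c) \<in> rwords B" using rwords_wpow[of "winv c" B "Suc k"] by simp
    then have "winv \<alpha> @ wpow k (winv c) \<in> rwords B" using cab by (simp add: rwords_append)
    then show ?thesis using y by (auto simp: rwords_append \<alpha>_def)
  qed
  \<comment> \<open>Beyond length \<open>N\<close> the sets \<open>Z\<close> and \<open>Y\<close>
    agree, so long words on the two rays carry the separation back to \<open>Y\<close>. The inserted
    \<open>0\<close> covers an empty difference.\<close>
  define N where "N = Max (insert 0 (length ` ((Z - Y) \<union> (Y - Z))))"
  have N: "w \<in> Z \<longleftrightarrow> w \<in> Y" if "length w > N" for w
  proof (rule ccontr)
    assume "\<not> (w \<in> Z \<longleftrightarrow> w \<in> Y)"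
    then have "length w \<le> N" unfolding N_def using diff by (intro Max_ge) auto
    with that show False by simp
  qed
  have len: "length (wpow (Suc N) w) > N" if "w \<noteq> []" for w :: "('a \<times> bool) list"
    using that by (cases w) (auto simp: length_concat sum_list_replicate)
  have cne: "c \<noteq> []" using cab \<beta>_def by simp
  have "v @ \<beta> @ wpow (Suc N) c \<in> Y \<longleftrightarrow> v \<notin> Z"
  proof -
    have "v @ \<beta> @ wpow (Suc N) c \<in> Z \<longleftrightarrow> v \<notin> Z"
      using deep[of z "q @ wpow (Suc N) c"] r1[of "Suc N"] vz' by (simp add: \<beta>_def)
    then show ?thesis using N[of "v @ \<beta> @ wpow (Suc N) c"] len[OF cne]
      by simp
  qed
  moreover have "v @ winv \<alpha> @ wpow (Suc N) (winv c) \<in> Y \<longleftrightarrow> v \<in> Z"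
  proof -
    have "v @ winv \<alpha> @ wpow (Suc N) (winv c) \<in> Z \<longleftrightarrow> v \<in> Z"
      using deep[of y "winv p @ wpow (Suc N) (winv c)"] r2[of "Suc N"] vy by (simp add: \<alpha>_def)
    then show ?thesis using N[of "v @ winv \<alpha> @ wpow (Suc N) (winv c)"] len[of "winv c"] cne
      by simp
  qed
  ultimately show ?thesis using that[OF cab r1 r2] by blast
qed

section \<open>Counting subwords\<close>

primrec occ :: "'b list \<Rightarrow> 'b list \<Rightarrow> nat" where
  "occ w [] = 0"
| "occ w (x # u) = of_bool (prefix w (x # u)) + occ w u"

lemma occ_append_ge: "occ w u + occ w v \<le> occ w (u @ v)"
proof (induction u)
  case (Cons x u)
  have "prefix w (x # u) \<Longrightarrow> prefix w (x # u @ v)"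
    by (metis append_Cons prefix_prefix)
  then show ?case using Cons by (auto simp: of_bool_def simp del: Cons_prefix_Cons)
qed simp

text \<open>Only occurrences starting among the last \<open>length w\<close> letters of
  \<open>u\<close> can reach into \<open>v\<close>. The minimum lets the induction charge one per
  letter until \<open>w\<close> fits into \<open>u\<close>.\<close>

lemma occ_append_le: "occ w (u @ v) \<le> occ w u + occ w v + min (length u) (length w)"
proof (induction u)
  case (Cons x u)
  show ?case
  proof (cases "length w \<le> length (x # u)")
    case True
    have "prefix w (x # u @ v) \<longleftrightarrow> prefix w (x # u)"
      using True prefix_length_prefix[of w "(x # u) @ v" "x # u"] prefix_prefix[of w "x # u" v]
      by auto
    then show ?thesis using Cons by auto
  next
    case False
    then show ?thesis using Cons by (auto simp: of_bool_def)
  qed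
qed simp

lemma occ_eq_0:
  assumes "\<not> sublist w u"
  shows "occ w u = 0"
  using assms
proof (induction u)
  case (Cons x u)
  then have "\<not> prefix w (x # u)" "\<not> sublist w u"
    using sublist_Cons_right[of w x u] by simp_all
  then show ?case using Cons by simp
qed simp

text \<open>Occurrences are counted by their right end instead of their left end, as inversion of
  words requires.\<close>

lemma occ_snoc:
  assumes "w \<noteq> []"
  shows "occ w (u @ [x]) = occ w u + of_bool (suffix w (u @ [x]))"
proof (induction u)
  case Nil
  show ?case using assms prefix_snoc[of w "[]" x] suffix_Cons[of w x "[]"] by (simp del: suffix_snoc)
next
  case (Cons a u)
  have "prefix w (a # u @ [x]) \<longleftrightarrow> w = a # u @ [x] \<or> prefix w (a # u)"
    using prefix_snoc[of w "a # u" x] by simp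
  moreover have "suffix w (a # u @ [x]) \<longleftrightarrow> w = a # u @ [x] \<or> suffix w (u @ [x])"
    by (rule suffix_Cons)
  moreover have "w = a # u @ [x] \<Longrightarrow> \<not> prefix w (a # u) \<and> \<not> suffix w (u @ [x])"
    using prefix_length_le[of w "a # u"] suffix_length_le[of w "u @ [x]"] by (auto simp del: suffix_snoc Cons_prefix_Cons)
  ultimately show ?case using Cons by (auto simp del: Cons_prefix_Cons suffix_snoc)
qed

lemma suffix_winv: "suffix (winv w) (winv v) \<longleftrightarrow> prefix w v"
  unfolding suffix_def prefix_def by (metis winv_simps(3,4))

lemma occ_winv:
  assumes "w \<noteq> []"
  shows "occ w (winv u) = occ (winv w) u"
proof (induction u)
  case (Cons x u)
  have "occ w (winv (x # u)) = occ w (winv u) + of_bool (suffix w (winv (x # u)))"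
    using occ_snoc[OF assms] by (simp del: suffix_snoc)
  also have "suffix w (winv (x # u)) \<longleftrightarrow> prefix (winv w) (x # u)"
    using suffix_winv[of "winv w" "x # u"] by (simp only: winv_simps)
  finally show ?case using Cons by (simp del: winv_simps)
qed simp

lemma occ_wpow_ge: "w \<noteq> [] \<Longrightarrow> k \<le> occ w (wpow k w)"
proof (induction k)
  case (Suc k)
  have "occ w w \<ge> 1" using Suc.prems by (cases w) auto
  then show ?case using Suc occ_append_ge[of w w "wpow k w"] by simp
qed simp

text \<open>The counting function of Brooks, in the version where overlapping occurrences
  count.\<close>

definition brooks :: "('a \<times> bool) list \<Rightarrow> ('a \<times> bool) list \<Rightarrow> int" where
  "brooks w u = int (occ w u) - int (occ (winv w) u)"

lemma brooks_Nil [simp]: "brooks w [] = 0"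
  by (simp add: brooks_def)

lemma brooks_winv: "w \<noteq> [] \<Longrightarrow> brooks w (winv u) = - brooks w u"
  using occ_winv[of w u] occ_winv[of "winv w" u] by (simp add: brooks_def)

lemma brooks_append: "\<bar>brooks w (u @ v) - brooks w u - brooks w v\<bar> \<le> int (length w)"
  using occ_append_ge[of w u v] occ_append_le[of w u v]
    occ_append_ge[of "winv w" u v] occ_append_le[of "winv w" u v]
  by (simp add: brooks_def)

text \<open>Each of three junctions costs \<open>length w\<close>, while \<open>t\<close> and
  \<open>winv t\<close> contribute opposite amounts. This becomes the defect of the
  quasimorphism.\<close>

lemma brooks_cancel:
  assumes "w \<noteq> []"
  shows "\<bar>brooks w (p @ q) - brooks w (p @ t) - brooks w (winv t @ q)\<bar> \<le> 3 * int (length w)"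
  using brooks_append[of w p q] brooks_append[of w p t] brooks_append[of w "winv t" q]
    brooks_winv[OF assms, of t] by linarith

lemma brooks_conj:
  assumes "w \<noteq> []"
  shows "\<bar>brooks w (u @ c @ winv u) - brooks w c\<bar> \<le> 2 * int (length w)"
  using brooks_append[of w u "c @ winv u"] brooks_append[of w c "winv u"]
    brooks_winv[OF assms, of u] by linarith

lemma brooks_eq_0: "\<not> sublist w u \<Longrightarrow> \<not> sublist (winv w) u \<Longrightarrow> brooks w u = 0"
  by (simp add: brooks_def occ_eq_0)

section \<open>Subwords of powers, detected by letter counts\<close>

lemma nth_wpow: "i < k * length w \<Longrightarrow> wpow k w ! i = w ! (i mod length w)"
proof (induction k arbitrary: i)
  case (Suc k)
  then show ?case
    by (cases "i < length w") (auto simp: nth_append le_mod_geq)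
qed simp

lemma length_wpow [simp]: "length (wpow k w) = k * length w"
  by (induction k) auto

lemma count_list_rotate: "count_list (rotate n w) a = count_list w a"
proof (induction n)
  case (Suc n)
  then show ?case by (cases "rotate n w") (auto split: if_splits)
qed simp

text \<open>A factor of a power of \<open>w\<close> with the length of \<open>w\<close> is a
  rotation of \<open>w\<close>, and rotation preserves letter counts. Differing counts therefore
  exclude a subword.\<close>

lemma count_list_sublist_wpow:
  assumes "sublist v (wpow k w)" "length v = length w"
  shows "count_list v a = count_list w a"
proof -
  obtain p q where pq: "wpow k w = p @ v @ q" using assms(1) unfolding sublist_def by blast
  have "v = rotate (length p) w"
  proof (rule nth_equalityI)
    fix i assume i: "i < length v"
    have "length p + length v + length q = k * length w"
      using arg_cong[OF pq, of length] by simp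
    then have "wpow k w ! (length p + i) = w ! ((length p + i) mod length w)"
      using i by (intro nth_wpow) simp
    moreover have "wpow k w ! (length p + i) = v ! i"
      using i pq by (simp add: nth_append)
    ultimately show "v ! i = rotate (length p) w ! i"
      using i assms(2) by (simp add: nth_rotate)
  qed (simp add: assms)
  then show ?thesis by (simp add: count_list_rotate)
qed

lemma count_list_winv: "count_list (winv w) a = count_list w (linv a)"
  by (induction w) (auto simp: linv_eq_iff)

section \<open>Construction of full words that can be told apart\<close>

lemma full_word_winv:
  assumes "full_word B w"
  shows "full_word B (winv w)"
  unfolding full_word_def
proof (intro allI impI)
  fix a b assume "[a, b] \<in> rwords B"
  then have "[linv b, linv a] \<in> rwords B" using rwords_winv[of "[a, b]" B] by simp
  then have "sublist [linv b, linv a] w" using assms unfolding full_word_def by blast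
  then obtain p q where "w = p @ [linv b, linv a] @ q" unfolding sublist_def by blast
  then have "winv w = winv q @ [a, b] @ winv p" by simp
  then show "sublist [a, b] (winv w)" unfolding sublist_def by blast
qed

lemma full_word_sublist: "full_word B w \<Longrightarrow> sublist w c \<Longrightarrow> full_word B c"
  unfolding full_word_def by (meson sublist_order.order.trans)

text \<open>A buffer letter that cancels on neither side joins each new word to those already
  collected.\<close>

lemma common_superword:
  assumes B: "card B \<ge> 2" and us: "set us \<subseteq> rwords B"
  obtains s where "s \<in> rwords B" "s \<noteq> []" "\<And>u. u \<in> set us \<Longrightarrow> sublist u s"
proof -
  have "\<exists>s \<in> rwords B. s \<noteq> [] \<and> (\<forall>u \<in> set us. sublist u s)"
    using us
  proof (induction us)
    case Nil
    obtain z where "z \<in> B \<times> (UNIV :: bool set)" using avoid_two_letters[OF B] .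
    then show ?case by (intro bexI[of _ "[z]"]) auto
  next
    case (Cons u us)
    then obtain s where s: "s \<in> rwords B" "s \<noteq> []" "\<forall>u \<in> set us. sublist u s" by auto
    obtain z where z: "z \<in> B \<times> UNIV" "z \<noteq> linv (last u)" "z \<noteq> linv (hd s)"
      using avoid_two_letters[OF B] .
    then have "hd s \<noteq> linv z" by (metis linv_linv)
    then have "[z] @ s \<in> rwords B" using s z by (subst rwords_append) auto
    then have "u @ [z] @ s \<in> rwords B" using Cons.prems z by (subst rwords_append) auto
    moreover have "sublist u (u @ [z] @ s)" "sublist s (u @ [z] @ s)"
      by (simp, metis append_assoc sublist_append_leftI)
    ultimately show ?case using s(3)
      by (intro bexI[of _ "u @ [z] @ s"]) (auto intro: sublist_order.order.trans)
  qed
  then show ?thesis using that by blast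
qed

lemma full_word_exists:
  assumes B: "card B \<ge> 2"
  obtains s where "s \<in> rwords B" "s \<noteq> []" "full_word B s"
proof -
  have fin: "finite B" using assms by (metis card.infinite not_numeral_le_zero)
  have "{[a, b] | a b. [a, b] \<in> rwords B} \<subseteq>
      (\<lambda>(a, b). [a, b]) ` ((B \<times> UNIV) \<times> (B \<times> UNIV))"
    by (auto simp: rwords_def)
  then have "finite {[a, b] | a b. [a, b] \<in> rwords B}"
    by (rule finite_subset) (simp add: fin)
  then obtain us where us: "set us = {[a, b] | a b. [a, b] \<in> rwords B}"
    using finite_list[of "{[a, b] | a b. [a, b] \<in> rwords B}"] by metis
  obtain s where "s \<in> rwords B" "s \<noteq> []" "\<And>u. u \<in> set us \<Longrightarrow> sublist u s"
    using common_superword[OF B, of us] unfolding us by blast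
  then show ?thesis using that unfolding full_word_def us by blast
qed

lemma reduced_word_replicate: "reduced_word (replicate k a)"
proof (induction k)
  case (Suc k)
  then show ?case by (cases k) auto
qed simp

lemma count_list_replicate: "count_list (replicate k a) b = (if a = b then k else 0)"
  by (induction k) auto

text \<open>\<open>t\<close> carries all two-letter words, a block of \<open>x\<close> encodes the
  index \<open>j\<close>, and a block of \<open>y\<close> pads to a common length. The block of
  \<open>x\<close> is longer than \<open>t\<close>, so that no inverse can contain as many letters
  \<open>x\<close>.\<close>

lemma separated_full_words:
  assumes B: "card B \<ge> 2"
  obtains w :: "nat \<Rightarrow> ('a \<times> bool) list" and l a where
    "\<forall>j<m. w j @ w j \<in> rwords B \<and> full_word B (w j) \<and> length (w j) = l" "l > 0"
    "\<forall>i<m. \<forall>j<m. (i \<noteq> j \<longrightarrow> count_list (w i) a \<noteq> count_list (w j) a) \<and>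
      count_list (winv (w i)) a \<noteq> count_list (w j) a"
proof -
  obtain x y where xy: "x \<in> B" "y \<in> B" "x \<noteq> y"
    using obtain_subset_with_card_n[OF B] by (metis card_2_iff insert_subset)
  obtain s where s: "s \<in> rwords B" "s \<noteq> []" "full_word B s"
    using full_word_exists[OF B] .
  \<comment> \<open>\<open>z\<close> separates the full word from the block of \<open>x\<close>;
    \<open>z'\<close> separates it from the final block of \<open>y\<close> when the word is
    repeated.\<close>
  obtain z where z: "z \<in> B \<times> UNIV" "z \<noteq> linv (last s)" "z \<noteq> linv (x, True)"
    using avoid_two_letters[OF B] .
  obtain z' where z': "z' \<in> B \<times> UNIV" "z' \<noteq> linv (hd s)" "z' \<noteq> linv (y, True)"
    using avoid_two_letters[OF B] .
  define t where "t = [z'] @ s @ [z]"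
  define w where "w j = t @ replicate (length t + j + 1) (x, True) @ replicate (m - j) (y, True)" for j
  have hds: "hd s \<noteq> linv z'" and hdx: "(x, True) \<noteq> linv z" using z z' by (metis linv_linv)+
  have "s @ [z] \<in> rwords B" using s z by (subst rwords_append) auto
  then have t: "t \<in> rwords B" unfolding t_def using s z' hds by (subst rwords_append) auto
  have ends: "t \<noteq> []" "hd t = z'" "last t = z" by (simp_all add: t_def)
  have rep: "replicate (length t + j + 1) (x, True) @ replicate (m - j) (y, True) \<in> rwords B" for j
    using xy by (auto simp: rwords_append rwords_def reduced_word_replicate linv_def reduced_word_append simp del: replicate.simps)
  have wR: "w j \<in> rwords B" for j
    unfolding w_def using t rep[of j] hdx ends by (subst rwords_append) auto
  have red: "w j @ w j \<in> rwords B" if "j < m" for j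
  proof -
    have "last (w j) = (y, True)" "hd (w j) = z'" using that ends by (auto simp: w_def)
    then show ?thesis using wR[of j] z' by (auto simp: rwords_append)
  qed
  have cnt: "count_list (w j) (x, True) = count_list t (x, True) + length t + j + 1" for j
    using xy by (simp add: w_def count_list_replicate del: replicate.simps)
  \<comment> \<open>In the inverse, letters \<open>(x, True)\<close> come from letters
    \<open>(x, False)\<close> of \<open>w j\<close>, which occur in \<open>t\<close> only.\<close>
  have cnt': "count_list (winv (w j)) (x, True) \<le> length t" for j
    using xy count_le_length[of t "(x, False)"]
    by (simp add: w_def count_list_winv linv_def count_list_replicate del: replicate.simps)
  have full: "full_word B (w j)" for j
  proof -
    have "w j = [z'] @ s @ ([z] @ replicate (length t + j + 1) (x, True) @ replicate (m - j) (y, True))"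
      by (simp add: w_def t_def)
    then have "sublist s (w j)" unfolding sublist_def by blast
    then show ?thesis using full_word_sublist s(3) by blast
  qed
  have "count_list (winv (w i)) (x, True) \<noteq> count_list (w j) (x, True)" for i j
    using cnt[of j] cnt'[of i] by simp
  then show ?thesis
    using red full by (intro that[of w "2 * length t + m + 1" "(x, True)"]) (auto simp: cnt, auto simp: w_def)
qed

text \<open>Equal lengths and different letter counts keep \<open>w i\<close> for
  \<open>i \<noteq> j\<close>, and the inverses of all these words, out of powers of
  \<open>w j\<close>. Only occurrences of \<open>w j\<close> remain, at least \<open>k\<close> of
  them.\<close>

lemma brooks_wpow:
  fixes w :: "nat \<Rightarrow> ('a \<times> bool) list"
  assumes len: "\<forall>j<m. length (w j) = l" "l > 0"
    and ne: "\<forall>i<m. \<forall>j<m. (i \<noteq> j \<longrightarrow> count_list (w i) a \<noteq> count_list (w j) a) \<and>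
      count_list (winv (w i)) a \<noteq> count_list (w j) a"
    and ij: "i < m" "j < m"
  shows "i \<noteq> j \<Longrightarrow> brooks (w i) (wpow k (w j)) = 0"
    and "int k \<le> brooks (w j) (wpow k (w j))"
proof -
  have inv: "\<not> sublist (winv (w i)) (wpow k (w j))" if "i < m" for i
    using count_list_sublist_wpow[of "winv (w i)" k "w j" a] ne len ij that by auto
  then show "i \<noteq> j \<Longrightarrow> brooks (w i) (wpow k (w j)) = 0"
    using count_list_sublist_wpow[of "w i" k "w j" a] ne len ij
    by (intro brooks_eq_0) auto
  have "w j \<noteq> []" using len ij by force
  then show "int k \<le> brooks (w j) (wpow k (w j))"
    using occ_wpow_ge[of "w j" k] occ_eq_0[OF inv[OF ij(2)]] by (simp add: brooks_def)
qed

section \<open>Free bases and separable elements\<close>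

context group
begin

section \<open>Evaluation of words, and automorphisms acting on separable elements\<close>

lemma mult_inv_cancel:
  assumes "x \<in> carrier G" "y \<in> carrier G"
  shows "x \<otimes> (inv x \<otimes> y) = y" "inv x \<otimes> (x \<otimes> y) = y"
  using assms by (simp_all add: m_assoc[symmetric])

definition letter_val :: "'a \<times> bool \<Rightarrow> 'a" where
  "letter_val y = (if snd y then fst y else inv (fst y))"

lemma word_eval_Nil [simp]: "word_eval G [] = \<one>"
  by (simp add: word_eval_def)

lemma word_eval_Cons [simp]: "word_eval G (y # w) = letter_val y \<otimes> word_eval G w"
  by (simp add: word_eval_def letter_val_def split: prod.split)

lemma letter_val_closed [simp]: "fst y \<in> carrier G \<Longrightarrow> letter_val y \<in> carrier G"
  by (simp add: letter_val_def)

lemma letter_val_linv [simp]: "fst y \<in> carrier G \<Longrightarrow> letter_val (linv y) = inv (letter_val y)"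
  by (simp add: letter_val_def linv_def)

lemma word_eval_closed [simp]: "set w \<subseteq> carrier G \<times> UNIV \<Longrightarrow> word_eval G w \<in> carrier G"
  by (induction w) auto

lemma word_eval_append:
  "set u \<subseteq> carrier G \<times> UNIV \<Longrightarrow> set v \<subseteq> carrier G \<times> UNIV \<Longrightarrow>
    word_eval G (u @ v) = word_eval G u \<otimes> word_eval G v"
proof (induction u)
  case (Cons y u)
  then have "fst y \<in> carrier G" by auto
  with Cons show ?case by (simp add: m_assoc)
qed simp

lemma word_eval_winv:
  "set w \<subseteq> carrier G \<times> UNIV \<Longrightarrow> word_eval G (winv w) = inv (word_eval G w)"
proof (induction w)
  case (Cons y w)
  then have "fst y \<in> carrier G" "fst (linv y) \<in> carrier G" by (auto simp: linv_def)
  moreover from this have "set [linv y] \<subseteq> carrier G \<times> UNIV" by (cases "linv y") auto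
  ultimately show ?case using Cons by (simp add: word_eval_append inv_mult_group)
qed simp

lemma word_eval_hom:
  assumes "h \<in> hom G G" "set w \<subseteq> carrier G \<times> UNIV"
  shows "word_eval G (map (map_prod h id) w) = h (word_eval G w)"
proof -
  interpret h: group_hom G G h by unfold_locales (rule assms(1))
  show ?thesis using assms(2)
    by (induction w) (auto simp: letter_val_def)
qed

text \<open>A word over the image lifts letter by letter to \<open>B\<close>, and a cancelling pair
  in the lift would map to a cancelling pair. Injectivity then carries nontriviality over.\<close>

lemma free_basis_iso:
  assumes B: "free_basis G B" and h: "h \<in> iso G G"
  shows "free_basis G (h ` B)"
proof -
  interpret h: group_hom G G h
    using h by unfold_locales (simp add: iso_def)
  have inj: "inj_on h (carrier G)" and surj: "h ` carrier G = carrier G"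
    using h by (auto simp: iso_def bij_betw_def)
  have BG: "B \<subseteq> carrier G" "generate G B = carrier G"
    and red: "\<And>w. w \<in> rwords B \<Longrightarrow> w \<noteq> [] \<Longrightarrow> word_eval G w \<noteq> \<one>"
    using B by (auto simp: free_basis_def rwords_def)
  have "word_eval G w \<noteq> \<one>"
    if w: "set w \<subseteq> h ` B \<times> UNIV" "reduced_word w" "w \<noteq> []" for w
  proof -
    have "h ` B \<times> (UNIV :: bool set) = map_prod h id ` (B \<times> UNIV)"
      by (rule map_prod_surj_on[symmetric]) auto
    then have "w \<in> lists (map_prod h id ` (B \<times> UNIV))" using w(1) by (simp add: lists_eq_set)
    then obtain v where v: "set v \<subseteq> B \<times> UNIV" "w = map (map_prod h id) v"
      by (auto simp: lists_image)
    have "reduced_word v"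
      using w(2) unfolding v(2) reduced_word_def by (auto simp: nth_map)
    then have "v \<in> rwords B" "v \<noteq> []" using v w(3) by (auto simp: rwords_def)
    then have "word_eval G v \<noteq> \<one>" by (rule red)
    moreover have v': "set v \<subseteq> carrier G \<times> UNIV" using v(1) BG(1) by auto
    ultimately have "h (word_eval G v) \<noteq> \<one>"
      using inj word_eval_closed[OF v'] by (metis h.hom_one inj_onD one_closed)
    then show ?thesis using word_eval_hom[OF h.homh v'] v(2) by simp
  qed
  moreover have "generate G (h ` B) = carrier G"
    using h.generate_img[OF BG(1)] BG(2) surj by simp
  ultimately show ?thesis using BG(1) by (auto simp: free_basis_def)
qed

lemma sepE:
  assumes "s \<in> sep G"
  obtains B A where "free_basis G B" "A \<subseteq> B" "generate G A \<noteq> carrier G" "s \<in> generate G A"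
  using assms unfolding sep_def proper_free_factor_def free_factor_def by blast

lemma sep_iso:
  assumes s: "s \<in> sep G" and h: "h \<in> iso G G"
  shows "h s \<in> sep G"
proof -
  interpret h: group_hom G G h
    using h by unfold_locales (simp add: iso_def)
  have inj: "inj_on h (carrier G)" and surj: "h ` carrier G = carrier G"
    using h by (auto simp: iso_def bij_betw_def)
  obtain B A where BA: "free_basis G B" "A \<subseteq> B" "generate G A \<noteq> carrier G" "s \<in> generate G A"
    using s by (rule sepE)
  have AG: "A \<subseteq> carrier G" using BA by (auto simp: free_basis_def)
  have img: "generate G (h ` A) = h ` generate G A" by (rule h.generate_img[OF AG])
  have "generate G (h ` A) \<noteq> carrier G"
    using BA(3) inj surj generate_incl[OF AG] inj_on_image_eq_iff[of h "carrier G" "generate G A" "carrier G"]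
    unfolding img by auto
  moreover have "free_factor G (generate G (h ` A))"
    unfolding free_factor_def using free_basis_iso[OF BA(1) h] BA(2) by blast
  moreover have "h s \<in> generate G (h ` A)" using BA(4) img by simp
  ultimately show ?thesis unfolding sep_def proper_free_factor_def by blast
qed

lemma conj_iso:
  assumes p: "p \<in> carrier G"
  shows "(\<lambda>x. p \<otimes> x \<otimes> inv p) \<in> iso G G"
proof -
  have "bij_betw (\<lambda>x. p \<otimes> x \<otimes> inv p) (carrier G) (carrier G)"
  proof (rule bij_betwI[of _ _ _ "\<lambda>x. inv p \<otimes> x \<otimes> p"])
    fix x assume x: "x \<in> carrier G"
    then show "inv p \<otimes> (p \<otimes> x \<otimes> inv p) \<otimes> p = x" "p \<otimes> (inv p \<otimes> x \<otimes> p) \<otimes> inv p = x"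
      using p by (simp_all add: m_assoc mult_inv_cancel)
  qed (use p in auto)
  moreover have "p \<otimes> (x \<otimes> y) \<otimes> inv p = (p \<otimes> x \<otimes> inv p) \<otimes> (p \<otimes> y \<otimes> inv p)"
    if "x \<in> carrier G" "y \<in> carrier G" for x y
    using p that by (simp add: m_assoc mult_inv_cancel)
  ultimately show ?thesis using p by (auto simp: iso_def hom_def)
qed

text \<open>Inner automorphisms. This makes the metric of the Cayley graph invariant on both
  sides.\<close>

lemma sep_conj: "s \<in> sep G \<Longrightarrow> p \<in> carrier G \<Longrightarrow> p \<otimes> s \<otimes> inv p \<in> sep G"
  using sep_iso[of s "\<lambda>x. p \<otimes> x \<otimes> inv p"] conj_iso[of p] by simp

lemma sep_closed: "s \<in> sep G \<Longrightarrow> s \<in> carrier G"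
  by (elim sepE) (meson free_basis_def generate_in_carrier subset_trans)

end

text \<open>The basis is a parameter because two bases meet later: the fixed one, and one that
  witnesses the separability of a given element.\<close>

locale based_free_group = group G for G (structure) +
  fixes B :: "'a set"
  assumes basis: "free_basis G B"
begin

lemma basis_closed: "B \<subseteq> carrier G"
  using basis by (simp add: free_basis_def)

lemma rwords_letters: "w \<in> rwords B \<Longrightarrow> set w \<subseteq> carrier G \<times> UNIV"
  using basis_closed by (auto simp: rwords_def)

lemma rwords_eval_closed [simp]: "w \<in> rwords B \<Longrightarrow> word_eval G w \<in> carrier G"
  by (simp add: rwords_letters)

lemma word_eval_mult:
  assumes u: "u \<in> rwords B" and v: "v \<in> rwords B"
  obtains p t q where "u = p @ t" "v = winv t @ q" "p @ q \<in> rwords B"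
    "word_eval G u \<otimes> word_eval G v = word_eval G (p @ q)"
proof -
  obtain p t q where ptq: "u = p @ t" "v = winv t @ q" "p @ q \<in> rwords B"
    using reduced_decomposition[OF u v] .
  then have parts: "p \<in> rwords B" "t \<in> rwords B" "q \<in> rwords B"
    using u v by (auto simp: rwords_append)
  then have "word_eval G u \<otimes> word_eval G v = word_eval G (p @ q)" using ptq
    by (simp add: word_eval_append word_eval_winv rwords_letters m_assoc mult_inv_cancel)
  then show ?thesis using that ptq by blast
qed

lemma word_eval_inj:
  assumes u: "u \<in> rwords B" and v: "v \<in> rwords B" and eq: "word_eval G u = word_eval G v"
  shows "u = v"
proof -
  have "winv u \<in> rwords B" using u by simp
  then obtain p t q where ptq: "winv u = p @ t" "v = winv t @ q" "p @ q \<in> rwords B"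
    "word_eval G (winv u) \<otimes> word_eval G v = word_eval G (p @ q)"
    using v by (rule word_eval_mult)
  have "word_eval G (winv u) \<otimes> word_eval G v = \<one>"
    using u v eq by (simp add: word_eval_winv rwords_letters)
  then have "word_eval G (p @ q) = \<one>" using ptq(4) by simp
  then have "p @ q = []"
    using basis ptq(3) unfolding free_basis_def rwords_def by blast
  then have "winv u = t" "v = winv t" using ptq by auto
  then show ?thesis by (metis winv_simps(4))
qed

lemma word_eval_surj:
  assumes "g \<in> carrier G"
  shows "\<exists>w \<in> rwords B. word_eval G w = g"
proof -
  have "g \<in> generate G B" using assms basis by (simp add: free_basis_def)
  then show ?thesis
  proof induction
    case one
    then show ?case by (intro bexI[of _ "[]"]) auto
  next
    case (incl h)
    then show ?case using basis_closed
      by (intro bexI[of _ "[(h, True)]"]) (auto simp: letter_val_def)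
  next
    case (inv h)
    then show ?case using basis_closed
      by (intro bexI[of _ "[(h, False)]"]) (auto simp: letter_val_def)
  next
    case (eng h1 h2)
    then show ?case by (metis word_eval_mult)
  qed
qed

section \<open>Normal forms and almost invariant half-trees\<close>

definition nf :: "'a \<Rightarrow> ('a \<times> bool) list" where
  "nf g = (SOME w. w \<in> rwords B \<and> word_eval G w = g)"

lemma nf_rwords [simp]: "g \<in> carrier G \<Longrightarrow> nf g \<in> rwords B"
  and eval_nf [simp]: "g \<in> carrier G \<Longrightarrow> word_eval G (nf g) = g"
  using someI_ex[of "\<lambda>w. w \<in> rwords B \<and> word_eval G w = g"] word_eval_surj[of g]
  unfolding nf_def by blast+

lemma nf_eval [simp]: "w \<in> rwords B \<Longrightarrow> nf (word_eval G w) = w"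
  by (intro word_eval_inj) auto

lemma nf_inv: "g \<in> carrier G \<Longrightarrow> nf (inv g) = winv (nf g)"
  by (intro word_eval_inj) (auto simp: word_eval_winv rwords_letters)

lemma nf_mult:
  assumes "g \<in> carrier G" "h \<in> carrier G"
  obtains p t q where "nf g = p @ t" "nf h = winv t @ q" "nf (g \<otimes> h) = p @ q"
  using word_eval_mult[of "nf g" "nf h"] assms by (metis eval_nf nf_rwords nf_eval)

text \<open>For \<open>b \<in> B\<close>, the half-tree beyond the edge from \<open>\<one>\<close>
  to \<open>b\<close> in the Cayley tree.\<close>

definition starts_with :: "'a \<Rightarrow> 'a set" where
  "starts_with b = {g \<in> carrier G. nf g \<noteq> [] \<and> hd (nf g) = (b, True)}"

text \<open>Right multiplication by a letter alters only the end of the normal form, so the first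
  letter can change only when one of the two normal forms is empty. The one edge crossed joins
  \<open>\<one>\<close> and \<open>b\<close>.\<close>

lemma starts_with_letter:
  assumes y: "y \<in> B \<times> UNIV" and g: "g \<in> carrier G"
    and change: "g \<in> starts_with b \<longleftrightarrow> g \<otimes> letter_val y \<notin> starts_with b"
  shows "fst y = b \<and> g \<in> {\<one>, inv (letter_val y)}"
proof -
  have yG: "fst y \<in> carrier G" using y basis_closed by auto
  have "nf (word_eval G [y]) = [y]" using y by (intro nf_eval) simp
  then have nfy: "nf (letter_val y) = [y]" using yG by simp
  obtain p t q where ptq: "nf g = p @ t" "[y] = winv t @ q" "nf (g \<otimes> letter_val y) = p @ q"
    using nf_mult[of g "letter_val y"] g yG nfy by auto
  have mem: "g \<in> starts_with b \<longleftrightarrow> nf g \<noteq> [] \<and> hd (nf g) = (b, True)"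
    "g \<otimes> letter_val y \<in> starts_with b \<longleftrightarrow> p @ q \<noteq> [] \<and> hd (p @ q) = (b, True)"
    using g yG ptq by (auto simp: starts_with_def)
  have ch: "p @ t \<noteq> [] \<and> hd (p @ t) = (b, True) \<longleftrightarrow> \<not> (p @ q \<noteq> [] \<and> hd (p @ q) = (b, True))"
    using change unfolding mem ptq(1) .
  show ?thesis
  proof (cases "t = []")
    case True
    then have "p = []" "y = (b, True)" using ch ptq(2) by (cases p; auto)+
    then have "g = word_eval G []" using ptq True g eval_nf[of g] by simp
    then show ?thesis using \<open>y = (b, True)\<close> by simp
  next
    case False
    then have "winv t = [y]" "q = []" using ptq(2) by (cases "winv t"; simp)+
    have "winv (winv t) = [linv y]" by (subst \<open>winv t = [y]\<close>) simp
    with \<open>q = []\<close> have t: "t = [linv y]" "q = []" by simp_all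
    then have "p = []" "linv y = (b, True)" using ch t by (cases p; auto)+
    then have "g = word_eval G [linv y]" using ptq t g eval_nf[of g] by simp
    then show ?thesis using \<open>linv y = (b, True)\<close> yG by (simp add: linv_def letter_val_def)
  qed
qed

text \<open>Steps along basis letters other than \<open>b\<close> never cross the single edge that
  bounds the half-tree.\<close>

lemma starts_with_invariant:
  assumes "A \<subseteq> B - {b}" "a \<in> generate G A" "g \<in> carrier G"
  shows "g \<otimes> a \<in> starts_with b \<longleftrightarrow> g \<in> starts_with b"
  using assms(2,3)
proof (induction arbitrary: g)
  case (incl h)
  then show ?case using starts_with_letter[of "(h, True)" g b] assms(1) by (auto simp: letter_val_def)
next
  case (inv h)
  then show ?case using starts_with_letter[of "(h, False)" g b] assms(1) by (auto simp: letter_val_def)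
next
  case (eng h1 h2)
  have "A \<subseteq> carrier G" using assms(1) basis_closed by auto
  then have "h1 \<in> carrier G" "h2 \<in> carrier G" using eng generate_in_carrier by blast+
  then show ?case using eng by (simp add: m_assoc[symmetric])
qed simp

text \<open>A single letter moves at most two elements across. For a product, an element that
  changes sides does so at the first factor or, translated by it, at the second.\<close>

lemma starts_with_almost_invariant:
  assumes "x \<in> carrier G"
  shows "finite {g \<in> carrier G. g \<in> starts_with b \<longleftrightarrow> g \<otimes> x \<notin> starts_with b}"
proof -
  have fin: "finite {g \<in> carrier G. g \<in> starts_with b \<longleftrightarrow> g \<otimes> letter_val y \<notin> starts_with b}"
    if "y \<in> B \<times> UNIV" for y
    by (rule finite_subset[of _ "{\<one>, inv (letter_val y)}"])
      (use starts_with_letter[OF that] in auto)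
  have "x \<in> generate G B" using assms basis by (simp add: free_basis_def)
  then show ?thesis
  proof induction
    case one
    show ?case by (rule finite_subset[of _ "{}"]) auto
  next
    case (incl h)
    then show ?case using fin[of "(h, True)"] by (simp add: letter_val_def)
  next
    case (inv h)
    then show ?case using fin[of "(h, False)"] by (simp add: letter_val_def)
  next
    case (eng h1 h2)
    let ?D = "\<lambda>x. {g \<in> carrier G. g \<in> starts_with b \<longleftrightarrow> g \<otimes> x \<notin> starts_with b}"
    have h: "h1 \<in> carrier G" "h2 \<in> carrier G"
      using eng basis_closed generate_in_carrier by blast+
    have "?D (h1 \<otimes> h2) \<subseteq> ?D h1 \<union> (\<lambda>g. g \<otimes> inv h1) ` ?D h2"
    proof
      fix g assume g: "g \<in> ?D (h1 \<otimes> h2)"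
      then have "g = (g \<otimes> h1) \<otimes> inv h1" using h by (simp add: m_assoc)
      moreover have "g \<otimes> h1 \<in> ?D h2" if "g \<notin> ?D h1" using g h that by (auto simp: m_assoc)
      ultimately show "g \<in> ?D h1 \<union> (\<lambda>g. g \<otimes> inv h1) ` ?D h2" by blast
    qed
    then show ?case using eng.IH by (meson finite_UnI finite_imageI finite_subset)
  qed
qed

lemma starts_with_infinite:
  assumes "b \<in> B"
  shows "infinite (starts_with b)" "infinite (carrier G - starts_with b)"
proof -
  let ?f = "\<lambda>e k. word_eval G (replicate (Suc k) (b, e))"
  have R: "replicate k (b, e) \<in> rwords B" for k e
    using assms reduced_word_replicate[of k "(b, e)"] by (auto simp: rwords_def)
  have inj: "inj (?f e)" for e
  proof (rule injI)
    fix i j assume "?f e i = ?f e j"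
    then have "replicate (Suc i) (b, e) = replicate (Suc j) (b, e)"
      by (rule word_eval_inj[OF R R])
    then show "i = j" by simp
  qed
  have "range (?f True) \<subseteq> starts_with b"
    using nf_eval[OF R] rwords_eval_closed[OF R]
    by (auto simp: starts_with_def simp del: word_eval_Cons replicate.simps)
  then show "infinite (starts_with b)"
    using inj finite_imageD infinite_UNIV_nat finite_subset by metis
  have "range (?f False) \<subseteq> carrier G - starts_with b"
    using nf_eval[OF R] rwords_eval_closed[OF R]
    by (auto simp: starts_with_def simp del: word_eval_Cons replicate.simps)
  then show "infinite (carrier G - starts_with b)"
    using inj finite_imageD infinite_UNIV_nat finite_subset by metis
qed

lemma word_eval_wpow:
  assumes "v \<in> rwords B"
  shows "word_eval G (wpow k v) = word_eval G v [^] k"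
proof (induction k)
  case (Suc k)
  have "word_eval G (wpow (Suc k) v) = word_eval G v \<otimes> word_eval G (wpow k v)"
    using rwords_letters[OF assms] by (simp add: word_eval_append UN_subset_iff)
  also have "\<dots> = word_eval G v [^] Suc k"
    unfolding Suc by (rule nat_pow_Suc2[symmetric]) (simp add: assms)
  finally show ?case .
qed simp

text \<open>The half-tree of a basis element outside the factor, stated without the witnessing basis
  so that it can be studied in the tree of \<open>B\<close>.\<close>

lemma sep_almost_invariant_set:
  assumes "s \<in> sep G"
  obtains A X where "A \<subseteq> carrier G" "s \<in> generate G A"
    "\<forall>a \<in> generate G A. \<forall>g \<in> carrier G. g \<otimes> a \<in> X \<longleftrightarrow> g \<in> X"
    "\<forall>x \<in> carrier G. finite {g \<in> carrier G. g \<in> X \<longleftrightarrow> g \<otimes> x \<notin> X}"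
    "X \<subseteq> carrier G" "infinite X" "infinite (carrier G - X)"
proof -
  obtain B' A where BA: "free_basis G B'" "A \<subseteq> B'" "generate G A \<noteq> carrier G" "s \<in> generate G A"
    using assms by (rule sepE)
  interpret other: based_free_group G B' by unfold_locales (rule BA(1))
  have "A \<noteq> B'" using BA(1,3) by (auto simp: free_basis_def)
  then obtain b where b: "b \<in> B'" "A \<subseteq> B' - {b}" using BA(2) by blast
  show ?thesis
  proof (rule that[of A "other.starts_with b"])
    show "A \<subseteq> carrier G" using BA(2) other.basis_closed by blast
    show "other.starts_with b \<subseteq> carrier G" by (auto simp: other.starts_with_def)
  qed (use BA b other.starts_with_invariant other.starts_with_almost_invariant
      other.starts_with_infinite in \<open>blast+\<close>)
qed

text \<open>If the word were full, a translate of its axis would have its ends on different sides of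
  \<open>X\<close>. But \<open>X\<close> is invariant under right multiplication by
  \<open>generate G A\<close>, so the points \<open>p\<close> times powers of \<open>s\<close> all
  lie on one side.\<close>

lemma sep_not_full:
  assumes B: "card B \<ge> 2" and s: "s \<in> sep G" and cyc: "nf s @ nf s \<in> rwords B"
  shows "\<not> full_word B (nf s)"
proof
  assume full: "full_word B (nf s)"
  have fin: "finite B" using B by (metis card.infinite not_numeral_le_zero)
  have sG: "s \<in> carrier G" by (rule sep_closed[OF s])
  obtain A X where A: "A \<subseteq> carrier G" "s \<in> generate G A"
    and inv: "\<forall>a \<in> generate G A. \<forall>g \<in> carrier G. g \<otimes> a \<in> X \<longleftrightarrow> g \<in> X"
    and finX: "\<forall>x \<in> carrier G. finite {g \<in> carrier G. g \<in> X \<longleftrightarrow> g \<otimes> x \<notin> X}"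
    and X: "X \<subseteq> carrier G" "infinite X" "infinite (carrier G - X)"
    by (rule sep_almost_invariant_set[OF s])
  interpret A: subgroup "generate G A" G by (rule generate_is_subgroup[OF A(1)])
  define Y where "Y = {v \<in> rwords B. word_eval G v \<in> X}"
  have eval_image: "g \<in> word_eval G ` S" if "g \<in> carrier G" "nf g \<in> S" for g S
    using that by (metis eval_nf imageI)
  have "X \<subseteq> word_eval G ` (rwords B \<inter> Y)"
    using X(1) by (intro subsetI eval_image) (auto simp: Y_def subset_iff)
  moreover have "carrier G - X \<subseteq> word_eval G ` (rwords B - Y)"
    by (intro subsetI eval_image) (auto simp: Y_def)
  ultimately have infY: "infinite (rwords B \<inter> Y)" "infinite (rwords B - Y)"
    using X(2,3) by (meson finite_imageI finite_subset)+
  \<comment> \<open>A tree edge is a right multiplication by one of finitely many letters, each of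
    which moves only finitely many elements across \<open>X\<close>.\<close>
  have "coboundary B Y \<subseteq> (\<Union>y \<in> B \<times> UNIV. (\<lambda>g. nf g @ [y]) `
      {g \<in> carrier G. g \<in> X \<longleftrightarrow> g \<otimes> letter_val y \<notin> X})"
  proof
    fix h assume "h \<in> coboundary B Y"
    then obtain v y where h: "h = v @ [y]" "v @ [y] \<in> rwords B" "v \<in> Y \<longleftrightarrow> v @ [y] \<notin> Y"
      by (rule coboundary_cases)
    then have v: "v \<in> rwords B" "y \<in> B \<times> UNIV" by (auto simp: rwords_append)
    then have yG: "fst y \<in> carrier G" using basis_closed by auto
    then have "word_eval G (v @ [y]) = word_eval G v \<otimes> letter_val y"
      using word_eval_append[OF rwords_letters[OF v(1)] rwords_letters[of "[y]"]] v(2) yG by simp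
    then have "word_eval G v \<in> {g \<in> carrier G. g \<in> X \<longleftrightarrow> g \<otimes> letter_val y \<notin> X}"
      using h v by (auto simp: Y_def)
    moreover have "h = nf (word_eval G v) @ [y]" using h v by simp
    ultimately show "h \<in> (\<Union>y \<in> B \<times> UNIV. (\<lambda>g. nf g @ [y]) `
      {g \<in> carrier G. g \<in> X \<longleftrightarrow> g \<otimes> letter_val y \<notin> X})" using v(2) by blast
  qed
  moreover have "finite (\<Union>y \<in> B \<times> UNIV. (\<lambda>g. nf g @ [y]) `
      {g \<in> carrier G. g \<in> X \<longleftrightarrow> g \<otimes> letter_val y \<notin> X})"
    using fin finX basis_closed by (intro finite_UN_I finite_imageI) auto
  ultimately have finY: "finite (coboundary B Y)" by (rule finite_subset)
  obtain v \<alpha> \<beta> k where vab: "nf s = \<alpha> @ \<beta>" "v @ \<beta> @ wpow k (nf s) \<in> rwords B"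
    "v @ winv \<alpha> @ wpow k (winv (nf s)) \<in> rwords B"
    "v @ \<beta> @ wpow k (nf s) \<in> Y \<longleftrightarrow> v @ winv \<alpha> @ wpow k (winv (nf s)) \<notin> Y"
    using separating_line[OF B finY infY cyc full] by metis
  have pow: "word_eval G (wpow k w) \<in> generate G A"
    if "word_eval G w \<in> generate G A" "w \<in> rwords B" for w k
  proof -
    have "word_eval G w [^] k \<in> generate G A"
      using that(1) by (induction k) auto
    then show ?thesis by (simp add: word_eval_wpow that(2))
  qed
  have R: "v \<in> rwords B" "\<alpha> \<in> rwords B" "\<beta> \<in> rwords B" "wpow k (nf s) \<in> rwords B"
      "wpow k (winv (nf s)) \<in> rwords B"
    using vab nf_rwords[OF sG] by (auto simp: rwords_append)
  have ev: "word_eval G v \<in> carrier G" "word_eval G \<alpha> \<in> carrier G" "word_eval G \<beta> \<in> carrier G"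
    "word_eval G (wpow k (nf s)) \<in> carrier G"
    using R by simp_all
  have sab: "word_eval G \<alpha> \<otimes> word_eval G \<beta> = s"
    using vab(1) eval_nf[OF sG] R by (simp add: word_eval_append rwords_letters)
  \<comment> \<open>The two words evaluate to \<open>p\<close> times \<open>s\<close> to the powers
    \<open>k + 1\<close> and \<open>- k\<close>: the factor \<alpha> missing from \<beta> is
    supplied by its inverse in \<open>p\<close>.\<close>
  define p where "p = word_eval G v \<otimes> inv (word_eval G \<alpha>)"
  have p: "p \<in> carrier G" using ev by (simp add: p_def)
  have bR: "\<beta> @ wpow k (nf s) \<in> rwords B" using vab(2) by (simp add: rwords_append)
  have "word_eval G (v @ \<beta> @ wpow k (nf s))
      = word_eval G v \<otimes> (word_eval G \<beta> \<otimes> word_eval G (wpow k (nf s)))"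
    using word_eval_append[OF rwords_letters[OF R(1)] rwords_letters[OF bR]]
      word_eval_append[OF rwords_letters[OF R(3)] rwords_letters[OF R(4)]] by simp
  moreover have "p \<otimes> (s \<otimes> t) = word_eval G v \<otimes> (word_eval G \<beta> \<otimes> t)" if "t \<in> carrier G" for t
    using ev that unfolding p_def sab[symmetric] by (simp add: m_assoc mult_inv_cancel)
  ultimately have "word_eval G (v @ \<beta> @ wpow k (nf s)) = p \<otimes> (s \<otimes> word_eval G (wpow k (nf s)))"
    using ev(4) by simp
  moreover have "word_eval G (wpow k (nf s)) \<in> generate G A"
    using pow[of "nf s" k] A sG by simp
  ultimately have 1: "word_eval G (v @ \<beta> @ wpow k (nf s)) \<in> X \<longleftrightarrow> p \<in> X"
    using inv A(2) p by simp
  have aR: "winv \<alpha> @ wpow k (winv (nf s)) \<in> rwords B" using vab(3) by (simp add: rwords_append)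
  have "word_eval G (v @ winv \<alpha> @ wpow k (winv (nf s))) = p \<otimes> word_eval G (wpow k (winv (nf s)))"
    using word_eval_append[OF rwords_letters[OF R(1)] rwords_letters[OF aR]]
      word_eval_append[OF rwords_letters[of "winv \<alpha>"] rwords_letters[OF R(5)]] R ev
    by (simp add: p_def word_eval_winv rwords_letters m_assoc)
  moreover have "word_eval G (wpow k (winv (nf s))) \<in> generate G A"
    using pow[of "winv (nf s)" k] A sG by (simp add: word_eval_winv rwords_letters)
  ultimately have 2: "word_eval G (v @ winv \<alpha> @ wpow k (winv (nf s))) \<in> X \<longleftrightarrow> p \<in> X"
    using inv p by simp
  show False using vab(2,3,4) 1 2 by (simp add: Y_def)
qed

text \<open>The half-tree of a second basis element \<open>b'\<close> is invariant under powers of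
  \<open>b\<close> but separates \<open>b'\<close> from \<open>\<one>\<close>, so the factor
  generated by \<open>b\<close> is proper.\<close>

lemma basis_sep:
  assumes "card B \<ge> 2" "b \<in> B"
  shows "b \<in> sep G"
proof -
  obtain b' where b': "b' \<in> B" "b' \<noteq> b"
    using obtain_subset_with_card_n[OF assms(1)] by (metis card_2_iff insert_subset)
  have b'G: "b' \<in> carrier G" using b' basis_closed by blast
  have "nf (word_eval G [(b', True)]) = [(b', True)]" using b' by (intro nf_eval) simp
  then have "b' \<in> starts_with b'" using b'G by (simp add: starts_with_def letter_val_def)
  moreover have "\<one> \<notin> starts_with b'" using nf_eval[of "[]"] by (simp add: starts_with_def)
  ultimately have "b' \<notin> generate G {b}"
    using starts_with_invariant[of "{b}" b' b' \<one>] assms b' b'G by auto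
  then have "generate G {b} \<noteq> carrier G" using b'G by blast
  moreover have "free_factor G (generate G {b})"
    unfolding free_factor_def using basis assms by blast
  ultimately show ?thesis
    unfolding sep_def proper_free_factor_def by (auto intro: generate.incl)
qed

section \<open>Counting quasimorphisms and the embedding\<close>

abbreviation qm :: "('a \<times> bool) list \<Rightarrow> 'a \<Rightarrow> int" where
  "qm w g \<equiv> brooks w (nf g)"

lemma qm_mult:
  assumes "w \<noteq> []" "g \<in> carrier G" "h \<in> carrier G"
  shows "\<bar>qm w (g \<otimes> h) - qm w g - qm w h\<bar> \<le> 3 * int (length w)"
  using nf_mult[OF assms(2,3)] brooks_cancel[OF assms(1)] by metis

lemma qm_inv: "w \<noteq> [] \<Longrightarrow> g \<in> carrier G \<Longrightarrow> qm w (inv g) = - qm w g"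
  by (simp add: nf_inv brooks_winv)

text \<open>Passing to the cyclically reduced core costs a bounded amount. The core is again
  separable, hence not full, hence contains neither \<open>w\<close> nor its inverse and counts
  zero.\<close>

lemma qm_sep:
  assumes B: "card B \<ge> 2" and w: "full_word B w" "w \<noteq> []" and s: "s \<in> sep G"
  shows "\<bar>qm w s\<bar> \<le> 2 * int (length w)"
proof -
  have sG: "s \<in> carrier G" by (rule sep_closed[OF s])
  obtain u c where uc: "nf s = u @ c @ winv u" "c @ c \<in> rwords B"
    using cyclic_reduction[of "nf s" B] sG by auto
  have R: "u \<in> rwords B" "c \<in> rwords B" using nf_rwords[OF sG] uc by (auto simp: rwords_append)
  then have ev: "word_eval G u \<in> carrier G" "word_eval G c \<in> carrier G" by simp_all
  have "s = word_eval G u \<otimes> word_eval G c \<otimes> inv (word_eval G u)"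
    using eval_nf[OF sG] R uc by (simp add: word_eval_append word_eval_winv rwords_letters m_assoc)
  then have "inv (word_eval G u) \<otimes> s \<otimes> inv (inv (word_eval G u)) = word_eval G c"
    using ev by (simp add: m_assoc mult_inv_cancel)
  then have "word_eval G c \<in> sep G" using sep_conj[OF s, of "inv (word_eval G u)"] ev by simp
  then have "\<not> full_word B c" using sep_not_full[OF B, of "word_eval G c"] R uc by simp
  then have "\<not> sublist w c" "\<not> sublist (winv w) c"
    using w full_word_winv full_word_sublist by blast+
  then have "brooks w c = 0" by (rule brooks_eq_0)
  then show ?thesis using brooks_conj[OF w(2), of u c] uc by simp
qed

text \<open>Each edge multiplies on the left by a separable element or its inverse:
  \<open>2 * length w\<close> for that element and \<open>3 * length w\<close> for the
  defect.\<close>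

lemma qm_path:
  assumes B: "card B \<ge> 2" and w: "full_word B w" "w \<noteq> []"
    and path: "(g, h) \<in> cay_edges G (sep G) ^^ k" and g: "g \<in> carrier G"
  shows "h \<in> carrier G \<and> \<bar>qm w (h \<otimes> inv g)\<bar> \<le> 5 * int (length w) * int k"
  using path
proof (induction k arbitrary: h)
  case 0
  then show ?case using g nf_eval[of "[]"] by simp
next
  case (Suc k)
  then obtain h' where h': "(g, h') \<in> cay_edges G (sep G) ^^ k" "(h', h) \<in> cay_edges G (sep G)"
    by auto
  then have hG: "h' \<in> carrier G" "h \<in> carrier G" by (auto simp: cay_edges_def)
  obtain t where t: "t \<in> carrier G" "h = t \<otimes> h'" "\<bar>qm w t\<bar> \<le> 2 * int (length w)"
  proof -
    obtain s where s: "s \<in> sep G" "h = s \<otimes> h' \<or> h' = s \<otimes> h"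
      using h'(2) by (auto simp: cay_edges_def)
    then have sG: "s \<in> carrier G" using sep_closed by blast
    have "h = s \<otimes> h' \<or> h = inv s \<otimes> h'" using s hG sG by (auto simp: mult_inv_cancel)
    then show ?thesis using that[of s] that[of "inv s"] qm_sep[OF B w s(1)] qm_inv[OF w(2) sG] sG
      by auto
  qed
  have "h \<otimes> inv g = t \<otimes> (h' \<otimes> inv g)" using t hG g by (simp add: m_assoc)
  then have "\<bar>qm w (h \<otimes> inv g) - qm w t - qm w (h' \<otimes> inv g)\<bar> \<le> 3 * int (length w)"
    using qm_mult[OF w(2) t(1), of "h' \<otimes> inv g"] hG g by simp
  then show ?case using Suc.IH[OF h'(1)] t(3) hG by (simp add: algebra_simps)
qed

text \<open>Inserting a basis letter between \<open>p\<close> and \<open>r\<close> is left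
  multiplication by a conjugate of that letter, so it is one edge wherever in the product it takes
  place.\<close>

lemma path_word:
  assumes B: "card B \<ge> 2" and w: "w \<in> rwords B"
    and pr: "p \<in> carrier G" "r \<in> carrier G"
  shows "(p \<otimes> r, p \<otimes> word_eval G w \<otimes> r) \<in> cay_edges G (sep G) ^^ length w"
  using w pr(1)
proof (induction w arbitrary: p)
  case Nil
  then show ?case by simp
next
  case (Cons y w)
  have y: "[y] \<in> rwords B" and w: "w \<in> rwords B"
    using Cons.prems rwords_append[of "[y]" w B] by auto
  then have yG: "fst y \<in> carrier G" "fst y \<in> B" using basis_closed by auto
  define b where "b = fst y"
  have b: "b \<in> carrier G" "b \<in> sep G" using yG basis_sep[OF B] by (auto simp: b_def)
  have conj: "p \<otimes> b \<otimes> inv p \<in> sep G" by (rule sep_conj[OF b(2) Cons.prems(2)])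
  have "p \<otimes> b \<otimes> r = p \<otimes> b \<otimes> inv p \<otimes> (p \<otimes> r)"
    "p \<otimes> r = p \<otimes> b \<otimes> inv p \<otimes> (p \<otimes> inv b \<otimes> r)"
    using b Cons.prems(2) pr(2) by (simp_all add: m_assoc mult_inv_cancel)
  then have "(p \<otimes> r, p \<otimes> letter_val y \<otimes> r) \<in> cay_edges G (sep G)"
    using conj b(1) Cons.prems(2) pr(2)
    unfolding cay_edges_def letter_val_def b_def[symmetric] by auto
  moreover have "(p \<otimes> letter_val y \<otimes> r, p \<otimes> letter_val y \<otimes> word_eval G w \<otimes> r)
      \<in> cay_edges G (sep G) ^^ length w"
    using Cons.IH[OF w, of "p \<otimes> letter_val y"] Cons.prems yG by simp
  moreover have "p \<otimes> letter_val y \<otimes> word_eval G w \<otimes> r = p \<otimes> word_eval G (y # w) \<otimes> r"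
    using Cons.prems yG w by (simp add: m_assoc)
  ultimately show ?case unfolding length_Cons by (metis relpow_Suc_I2)
qed

section \<open>Products of integer powers: upper and lower bounds\<close>

definition zpow :: "('a \<times> bool) list \<Rightarrow> int \<Rightarrow> ('a \<times> bool) list" where
  "zpow w k = (if k < 0 then wpow (nat (- k)) (winv w) else wpow (nat k) w)"

lemma zpow_rwords: "w @ w \<in> rwords B \<Longrightarrow> zpow w k \<in> rwords B"
  using rwords_wpow[of w B] rwords_wpow[of "winv w" B] rwords_winv[of "w @ w" B]
  by (simp add: zpow_def)

lemma length_zpow: "length (zpow w k) = nat \<bar>k\<bar> * length w"
  by (simp add: zpow_def)

lemma eval_zpow:
  assumes "w @ w \<in> rwords B"
  shows "word_eval G (zpow w k) = word_eval G w [^] k"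
proof -
  have "w \<in> rwords B" using assms by (simp add: rwords_append)
  then have "word_eval G (wpow j (winv w)) = inv (word_eval G w [^] j)"
    "word_eval G (wpow j w) = word_eval G w [^] j" for j
    using word_eval_wpow[of w j] word_eval_wpow[of "winv w" j] nat_pow_inv[of "word_eval G w" j]
    by (simp_all only: rwords_winv word_eval_winv rwords_letters rwords_eval_closed)
  then show ?thesis unfolding zpow_def int_pow_def2 by (simp split: if_split)
qed

lemma nf_int_pow: "w @ w \<in> rwords B \<Longrightarrow> nf (word_eval G w [^] (k :: int)) = zpow w k"
  using eval_zpow zpow_rwords nf_eval by metis

primrec power_product :: "(nat \<Rightarrow> 'a) \<Rightarrow> nat \<Rightarrow> int list \<Rightarrow> 'a" where
  "power_product g 0 x = \<one>"
| "power_product g (Suc k) x = power_product g k x \<otimes> g k [^] (x ! k)"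

lemma power_product_closed:
  "(\<And>j. j < k \<Longrightarrow> g j \<in> carrier G) \<Longrightarrow> power_product g k x \<in> carrier G"
  by (induction k) auto

text \<open>Coordinates are changed one at a time. The tail \<open>r\<close> is arbitrary so that it
  can absorb the factors to the right of the part being changed.\<close>

lemma path_power_product:
  assumes B: "card B \<ge> 2" and w: "\<And>j. j < k \<Longrightarrow> w j @ w j \<in> rwords B"
    and len: "\<And>j. j < k \<Longrightarrow> length (w j) = l" and r: "r \<in> carrier G"
  shows "(power_product (\<lambda>j. word_eval G (w j)) k x \<otimes> r,
      power_product (\<lambda>j. word_eval G (w j)) k y \<otimes> r)
    \<in> cay_edges G (sep G) ^^ (l * nat (\<Sum>i<k. \<bar>x ! i - y ! i\<bar>))"
  using w len r
proof (induction k arbitrary: r)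
  case (Suc k)
  let ?g = "\<lambda>j. word_eval G (w j)"
  let ?P = "power_product ?g k"
  have wR: "w j \<in> rwords B" if "j < Suc k" for j using Suc.prems(1)[OF that] by (simp add: rwords_append)
  have g: "?g j \<in> carrier G" if "j < Suc k" for j using wR[OF that] by simp
  have P: "?P z \<in> carrier G" for z by (rule power_product_closed) (simp add: g)
  define d where "d = y ! k - x ! k"
  have gk: "?g k \<in> carrier G" by (simp add: g)
  define a where "a = ?g k [^] (x ! k)"
  have a: "a \<in> carrier G" using gk by (simp add: a_def)
  have "(?P x \<otimes> (a \<otimes> r), ?P y \<otimes> (a \<otimes> r))
      \<in> cay_edges G (sep G) ^^ (l * nat (\<Sum>i<k. \<bar>x ! i - y ! i\<bar>))"
    using Suc.prems a by (intro Suc.IH) auto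
  moreover have "(?P y \<otimes> (a \<otimes> r), ?P y \<otimes> word_eval G (zpow (w k) d) \<otimes> (a \<otimes> r))
      \<in> cay_edges G (sep G) ^^ length (zpow (w k) d)"
    using Suc.prems P a by (intro path_word[OF B] zpow_rwords) auto
  moreover have "?P y \<otimes> word_eval G (zpow (w k) d) \<otimes> (a \<otimes> r) = ?P y \<otimes> ?g k [^] (y ! k) \<otimes> r"
  proof -
    have "word_eval G (zpow (w k) d) \<otimes> a = ?g k [^] (y ! k)"
      using Suc.prems(1) gk by (simp add: eval_zpow a_def d_def int_pow_mult[symmetric])
    then show ?thesis using P[of y] a gk Suc.prems(1,3)
      by (simp add: m_assoc[symmetric] eval_zpow) (simp add: m_assoc)
  qed
  moreover have "length (zpow (w k) d) = l * nat \<bar>x ! k - y ! k\<bar>"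
    using Suc.prems(2) by (simp add: length_zpow d_def abs_minus_commute)
  ultimately have "(?P x \<otimes> (a \<otimes> r), ?P y \<otimes> ?g k [^] (y ! k) \<otimes> r) \<in> cay_edges G (sep G)
      ^^ (l * nat (\<Sum>i<k. \<bar>x ! i - y ! i\<bar>) + l * nat \<bar>x ! k - y ! k\<bar>)"
    unfolding relpow_add by auto
  moreover have "l * nat (\<Sum>i<k. \<bar>x ! i - y ! i\<bar>) + l * nat \<bar>x ! k - y ! k\<bar>
      = l * nat (\<Sum>i<Suc k. \<bar>x ! i - y ! i\<bar>)"
    by (simp add: nat_add_distrib sum_nonneg distrib_left)
  moreover have "?P x \<otimes> (a \<otimes> r) = power_product ?g (Suc k) x \<otimes> r"
    using P[of x] a Suc.prems(3) by (simp add: a_def m_assoc)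
  ultimately show ?case by simp
qed simp

text \<open>Each of the \<open>k\<close> multiplications costs one defect, and only the
  \<open>j\<close>-th factor can have a nonzero count; it enters once the prefix has passed
  \<open>j\<close>.\<close>

lemma qm_power_product:
  assumes w: "\<And>j. j < m \<Longrightarrow> w j @ w j \<in> rwords B" and v: "v \<noteq> []"
    and k: "k \<le> m" and zero: "\<And>i e. i < m \<Longrightarrow> i \<noteq> j \<Longrightarrow> brooks v (zpow (w i) e) = 0"
  shows "\<bar>qm v (power_product (\<lambda>j. word_eval G (w j)) k x)
      - (if j < k then brooks v (zpow (w j) (x ! j)) else 0)\<bar> \<le> 3 * int (length v) * int k"
  using k
proof (induction k)
  case 0
  then show ?case using nf_eval[of "[]"] by simp
next
  case (Suc k)
  let ?g = "\<lambda>j. word_eval G (w j)"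
  have g: "?g j \<in> carrier G" if "j < m" for j
    using w[OF that] by (simp add: rwords_append)
  have P: "power_product ?g k x \<in> carrier G"
    using Suc.prems by (intro power_product_closed g) simp
  have "qm v (?g k [^] (x ! k)) = brooks v (zpow (w k) (x ! k))"
    using Suc.prems w by (simp add: nf_int_pow)
  moreover have "\<bar>qm v (power_product ?g (Suc k) x) - qm v (power_product ?g k x)
      - qm v (?g k [^] (x ! k))\<bar> \<le> 3 * int (length v)"
    using qm_mult[OF v P, of "?g k [^] (x ! k)"] g[of k] Suc.prems by simp
  moreover have "k \<noteq> j \<Longrightarrow> brooks v (zpow (w k) (x ! k)) = 0" using zero Suc.prems by simp
  ultimately show ?case using Suc
    by (cases "k = j"; cases "j < k") (auto simp: algebra_simps simp del: power_product.simps)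
qed

text \<open>The quasimorphism of \<open>w j\<close> on the quotient of the endpoints is bounded
  along the path, and through the products it is close to its value on the quotient of the
  \<open>j\<close>-th factors.\<close>

lemma coordinate_bound:
  assumes B: "card B \<ge> 2"
    and w: "\<And>j. j < m \<Longrightarrow> w j @ w j \<in> rwords B" "full_word B (w j)" "length (w j) = l" "l > 0"
    and j: "j < m" and zero: "\<And>i e. i < m \<Longrightarrow> i \<noteq> j \<Longrightarrow> brooks (w j) (zpow (w i) e) = 0"
    and growth: "\<And>e. \<bar>e\<bar> \<le> \<bar>brooks (w j) (zpow (w j) e)\<bar>"
    and path: "(power_product (\<lambda>j. word_eval G (w j)) m x,
      power_product (\<lambda>j. word_eval G (w j)) m y) \<in> cay_edges G (sep G) ^^ k"
  shows "\<bar>x ! j - y ! j\<bar> \<le> 5 * int l * int k + 6 * int l * (int m + 1)"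
proof -
  let ?g = "\<lambda>j. word_eval G (w j)"
  let ?P = "power_product ?g m"
  let ?q = "qm (w j)"
  have ne: "w j \<noteq> []" using w by auto
  have g: "?g i \<in> carrier G" if "i < m" for i
    using w(1)[OF that] by (simp add: rwords_append)
  have P: "?P z \<in> carrier G" for z by (intro power_product_closed g)
  have z: "?q (?g j [^] e) = brooks (w j) (zpow (w j) e)" for e :: int
    using w(1)[OF j] by (simp add: nf_int_pow)
  have prod: "\<bar>?q (?P u) - ?q (?g j [^] (u ! j))\<bar> \<le> 3 * int l * int m" for u
    using qm_power_product[where w = w and v = "w j" and j = j and k = m and m = m and x = u]
      w(1) ne zero j w(3) z by simp
  \<comment> \<open>\<open>growth\<close> concerns single powers, so the difference of the
    coordinates is collected in one exponent.\<close>
  have "?g j [^] (x ! j - y ! j) = ?g j [^] (x ! j) \<otimes> inv (?g j [^] (y ! j))"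
    using g[OF j] by (simp add: int_pow_diff)
  then have "\<bar>?q (?g j [^] (x ! j - y ! j)) - ?q (?g j [^] (x ! j)) + ?q (?g j [^] (y ! j))\<bar> \<le> 3 * int l"
    using qm_mult[OF ne, of "?g j [^] (x ! j)" "inv (?g j [^] (y ! j))"] g[OF j] w(3)
    by (simp add: qm_inv[OF ne])
  moreover have "\<bar>x ! j - y ! j\<bar> \<le> \<bar>?q (?g j [^] (x ! j - y ! j))\<bar>"
    using growth z by simp
  moreover have "\<bar>?q (?P y \<otimes> inv (?P x)) - ?q (?P y) + ?q (?P x)\<bar> \<le> 3 * int l"
    using qm_mult[OF ne P[of y], of "inv (?P x)"] P[of x] w(3) by (simp add: qm_inv[OF ne])
  moreover have "\<bar>?q (?P y \<otimes> inv (?P x))\<bar> \<le> 5 * int l * int k"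
    using qm_path[OF B w(2) ne path P] w(3) by simp
  \<comment> \<open>The two products contribute \<open>3 * l * m\<close> each, the two quotients
    \<open>3 * l\<close> each.\<close>
  ultimately have "\<bar>x ! j - y ! j\<bar> \<le> 5 * int l * int k + 6 * (int l * int m) + 6 * int l"
    using prod[of x] prod[of y] by linarith
  then show ?thesis by (simp add: algebra_simps)
qed

lemma quasi_isometric_embedding:
  assumes B: "card B \<ge> 2"
  shows "\<exists>f. qi_embedding_Zm m G (sep G) f"
proof -
  obtain w :: "nat \<Rightarrow> ('a \<times> bool) list" and l a where
    W: "\<forall>j<m. w j @ w j \<in> rwords B \<and> full_word B (w j) \<and> length (w j) = l" and "l > 0"
    and C: "\<forall>i<m. \<forall>j<m. (i \<noteq> j \<longrightarrow> count_list (w i) a \<noteq> count_list (w j) a) \<and>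
      count_list (winv (w i)) a \<noteq> count_list (w j) a"
    using separated_full_words[OF B, where m = m] by metis
  have w: "\<And>j. j < m \<Longrightarrow> w j @ w j \<in> rwords B" "\<And>j. j < m \<Longrightarrow> full_word B (w j)"
    and len: "\<And>j. j < m \<Longrightarrow> length (w j) = l" "l > 0"
    using W \<open>l > 0\<close> by blast+
  let ?f = "power_product (\<lambda>j. word_eval G (w j)) m"
  let ?E = "cay_edges G (sep G)"
  have "\<forall>j<m. length (w j) = l" using W by blast
  note pow = brooks_wpow[OF this \<open>l > 0\<close> C]
  have g: "word_eval G (w i) \<in> carrier G" if "i < m" for i
    using w(1)[OF that] by (simp add: rwords_append)
  have f: "?f x \<in> carrier G" for x by (intro power_product_closed g)
  have ne: "w j \<noteq> []" if "j < m" for j using len that by force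
  \<comment> \<open>Negative exponents reduce to positive ones because the count is antisymmetric
    under inversion.\<close>
  have zero: "brooks (w j) (zpow (w i) e) = 0" if "i < m" "j < m" "i \<noteq> j" for i j e
    using pow(1)[OF that(2,1)] that ne[OF that(2)]
    by (auto simp: zpow_def winv_wpow[symmetric] brooks_winv)
  have growth: "\<bar>e\<bar> \<le> \<bar>brooks (w j) (zpow (w j) e)\<bar>" if "j < m" for j e
    using pow(2)[OF that that, of "nat \<bar>e\<bar>"] ne[OF that]
    by (auto simp: zpow_def winv_wpow[symmetric] brooks_winv)
  have path: "(?f x, ?f y) \<in> ?E ^^ (l * nat (\<Sum>i<m. \<bar>x ! i - y ! i\<bar>))" for x y
    using path_power_product[where r = \<one> and k = m and w = w and l = l and x = x and y = y,
        OF B w(1) len(1)] f by simp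
  \<comment> \<open>Summing the coordinate bounds gives the factors \<open>5 * l * m\<close> for the
    distance and \<open>l * m\<close> for \<open>C\<close>; \<open>L\<close> dominates both. The
    summand \<open>l\<close> serves the upper bound and keeps \<open>L \<ge> 1\<close> when
    \<open>m = 0\<close>.\<close>
  define L C :: real where "L = 5 * l * m + l" and "C = 6 * (m + 1)"
  have "real l \<ge> 1" "5 * real l * real m \<ge> 0" using len(2) by auto
  then have L: "L \<ge> 1" "C \<ge> 0" unfolding L_def C_def by linarith+
  have bounds: "real_of_int (l1_dist x y) / L - C \<le> real (cay_dist G (sep G) (?f x) (?f y)) \<and>
      real (cay_dist G (sep G) (?f x) (?f y)) \<le> L * real_of_int (l1_dist x y) + C"
    if "length x = m" for x y
  proof -
    define D where "D = cay_dist G (sep G) (?f x) (?f y)"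
    have l1: "l1_dist x y = (\<Sum>i<m. \<bar>x ! i - y ! i\<bar>)" using that by (simp add: l1_dist_def)
    have nn: "l1_dist x y \<ge> 0" unfolding l1 by (simp add: sum_nonneg)
    have "D \<le> l * nat (l1_dist x y)"
      unfolding D_def cay_dist_def l1 by (rule Least_le) (rule path)
    then have "real D \<le> real (l * nat (l1_dist x y))" by (rule of_nat_mono)
    also have "\<dots> = l * real_of_int (l1_dist x y)" using nn by simp
    also have "\<dots> \<le> L * real_of_int (l1_dist x y)"
      using nn by (intro mult_right_mono) (auto simp: L_def)
    finally have upper: "real D \<le> L * real_of_int (l1_dist x y)" .
    \<comment> \<open>A path exists, so the minimum defining the distance is attained and
      \<open>D\<close> is itself the length of a path.\<close>
    have "(?f x, ?f y) \<in> ?E ^^ D"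
      unfolding D_def cay_dist_def by (rule LeastI) (rule path)
    then have "\<bar>x ! j - y ! j\<bar> \<le> 5 * int l * int D + 6 * int l * (int m + 1)" if "j < m" for j
      using that w len zero growth by (intro coordinate_bound[OF B]) auto
    then have "l1_dist x y \<le> (\<Sum>j<m. 5 * int l * int D + 6 * int l * (int m + 1))"
      unfolding l1 by (intro sum_mono) simp
    then have "real_of_int (l1_dist x y) \<le> real_of_int (int m * (5 * int l * int D + 6 * int l * (int m + 1)))"
      by (subst of_int_le_iff) simp
    also have "\<dots> = 5 * l * m * real D + l * m * C" by (simp add: C_def algebra_simps)
    also have "\<dots> \<le> L * real D + L * C"
    proof (intro add_mono mult_right_mono)
      show "real (l * m) \<le> L" by (simp add: L_def)
    qed (use L in \<open>auto simp: L_def\<close>)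
    finally have "real_of_int (l1_dist x y) / L \<le> real D + C"
      using L by (simp add: field_simps)
    then show ?thesis using upper L unfolding D_def by simp
  qed
  have "qi_embedding_Zm m G (sep G) ?f"
    unfolding qi_embedding_Zm_def using f bounds L by blast
  then show ?thesis by blast
qed

end

theorem mainTheorem8:
  fixes G :: "('a, 'b) monoid_scheme" and n :: nat
  assumes "n \<ge> 2" and "free_group_rank G n"
  shows "\<forall>m::nat. \<exists>f. qi_embedding_Zm m G (sep G) f"
proof
  fix m :: nat
  obtain B where "group G" "free_basis G B" "card B = n"
    using assms(2) by (auto simp: free_group_rank_def)
  then interpret based_free_group G B
    by (simp add: based_free_group_def based_free_group_axioms_def)
  show "\<exists>f. qi_embedding_Zm m G (sep G) f"
    using quasi_isometric_embedding assms(1) \<open>card B = n\<close> by simp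
qed

end
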